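(* Let $a>0$ be real and $k\in\mathbb{N}$. Then $$\sum_{n=1}^\infty\frac{H_n^2}{(n+a)\binom{n+k+a}{k}}=\sum_{r=1}^{k}(-1)^{r+1}\binom{k}{r}\left\{\begin{aligned}&\zeta(2)H_r^{(1)}(a-1)-H_aH_r^{(2)}(a-1)\\&-\sum_{i=1}^{r-1}\frac{H_i^{(1)}(a)}{(i+a)^2}+\sum_{j=1}^r\frac{H_{a+j-1}^2+H_{a+j-1}^{(2)}}{a+j-1}\end{aligned}\right\}.$$
   Context: $\mathbb{N}=\{1,2,3,\ldots\}$. For $n\in\mathbb{N}$, $H_n=\sum_{j=1}^n \frac1j$. Shifted harmonic numbers: for $\alpha\in\mathbb{C}\setminus\{-1,-2,\ldots\}$, $H_\alpha=\psi(\alpha+1)+\gamma=\sum_{l=1}^\infty\left(\frac1l-\frac1{l+\alpha}\right)$ ($\psi$ the digamma function, $\gamma$ the Euler–Mascheroni constant) and $H_\alpha^{(2)}=\zeta(2)-\zeta(2,\alpha+1)$, where $\zeta(s,c)=\sum_{n=0}^\infty (n+c)^{-s}$ is the Hurwitz zeta function and $\zeta$ the Riemann zeta function. Parametric harmonic numbers: $H_n^{(s)}(c)=\sum_{j=1}^n (j+c)^{-s}$ for $n\ge 0$, $c\in\mathbb{C}\setminus\{-1,-2,\ldots\}$. For real or complex $u$ and $k\in\mathbb{N}$, $\binom{u}{k}=\frac{u(u-1)\cdots(u-k+1)}{k!}$. Empty sums are $0$. The series on the left is denoted $W_k^{(a,a)}(1,1,1)$ in the paper. *)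

theory Defs
  imports "HOL-Analysis.Analysis"
begin

text \<open>
  Only natural exponents \<open>s\<close> occur, so powers are the ordinary \<open>^\<close>; this keeps the definitions
  correct for every admissible real or complex \<open>c\<close>, without a choice of logarithm.
  The zeta functions are given by their series and are meaningful for \<open>s \<ge> 2\<close> only
  (and for \<open>c\<close> not a non-positive integer).
\<close>

definition riemann_zeta_nat :: "nat \<Rightarrow> 'a :: {real_normed_field, banach}" where
  "riemann_zeta_nat s = (\<Sum>n. 1 / of_nat (Suc n) ^ s)"

definition hurwitz_zeta_nat :: "nat \<Rightarrow> 'a :: {real_normed_field, banach} \<Rightarrow> 'a" where
  "hurwitz_zeta_nat s c = (\<Sum>n. 1 / (of_nat n + c) ^ s)"

definition shifted_harm :: "'a :: {real_normed_field, banach} \<Rightarrow> 'a" where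
  "shifted_harm \<alpha> = Digamma (\<alpha> + 1) + euler_mascheroni"

definition shifted_harm2 :: "'a :: {real_normed_field, banach} \<Rightarrow> 'a" where
  "shifted_harm2 \<alpha> = riemann_zeta_nat 2 - hurwitz_zeta_nat 2 (\<alpha> + 1)"

text \<open>The parametric harmonic numbers \<open>H\<^sub>n\<^sup>(\<^sup>s\<^sup>)(c)\<close>; note the argument order \<open>s\<close>, \<open>n\<close>, \<open>c\<close>.\<close>

definition param_harm :: "nat \<Rightarrow> nat \<Rightarrow> 'a :: field \<Rightarrow> 'a" where
  "param_harm s n c = (\<Sum>j=1..n. 1 / (of_nat j + c) ^ s)"

lemma shifted_harm_of_nat: "shifted_harm (of_nat n :: 'a :: {real_normed_field, banach}) = harm n"
  using Digamma_of_nat[of n, where ?'a = 'a]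
  by (simp add: shifted_harm_def add.commute)

end

theory Submission
  imports Defs "HOL-Real_Asymp.Real_Asymp"
begin

text \<open>
  The denominator is split by partial fractions: \<open>1 / (x * ((x + k) gchoose k))\<close> is, up to
  sign, the \<open>k\<close>-th difference of \<open>1 / x\<close>, hence an alternating binomial combination of the
  differences \<open>1 / x - 1 / (x + r)\<close> with \<open>1 \<le> r \<le> k\<close>. Each of these telescopes into
  \<open>r\<close> unit steps, so everything is reduced to
  \<open>T b = (\<Sum>n\<ge>1. (harm n)\<^sup>2 * (1 / (n + b) - 1 / (n + b + 1)))\<close>
  at \<open>b = a, a + 1, \<dots>, a + r - 1\<close>.

  Abel summation replaces the square in \<open>T b\<close> by
  \<open>(harm n)\<^sup>2 - (harm (n - 1))\<^sup>2 = 2 * harm n / n - 1 / n\<^sup>2\<close>. This leaves two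
  elementary series and the linear one
  \<open>F b = (\<Sum>n\<ge>1. harm n * (1 / n - 1 / (n + b)))\<close>, whose value, with \<open>H\<close> and \<open>H2\<close>
  for the shifted harmonic numbers of order one and two, is
  \<open>F b = ((H (b - 1))\<^sup>2 + H2 (b - 1)) / 2 + \<zeta>(2)\<close> (\<open>harm_series_closed_form\<close>).

  The evaluation of \<open>F\<close> is in the spirit of the Bohr-Mollerup theorem. A second Abel
  summation gives \<open>F (b + 1) = F b + H b / b\<close>, the right-hand side satisfies the
  same recurrence, and both sides are \<open>\<zeta>(2)\<close> at \<open>b = 1\<close>; their difference is thus a
  function of period one that vanishes at the positive integers. Both sides are increasing
  on \<open>[1, \<infinity>)\<close> and their increments \<open>H n / n\<close> tend to zero, so far out neither can move
  appreciably between consecutive integers, and the periodic difference must vanish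
  everywhere (\<open>eq_of_recurrence_of_mono\<close>).

  The closed form of \<open>T b\<close> contains \<open>- H b / b\<^sup>2\<close>. Expanding
  \<open>H (a + i) = H a + param_harm 1 i a\<close> in the sum of these terms over \<open>b\<close> yields the terms
  with \<open>H a\<close> and the double sum of the theorem.
\<close>

section \<open>Harmonic numbers and Abel summation\<close>

text \<open>
  The boundary term \<open>u N * v (N + 1)\<close> of summation by parts telescopes to zero, so the series
  in the differences of \<open>u\<close> and the one in the differences of \<open>v\<close> have the same sum.
\<close>
lemma Abel_summation_sums:
  fixes u v :: "nat \<Rightarrow> real"
  assumes "(\<lambda>n. (u (Suc n) - u n) * v (Suc n)) sums S"
    and "u 0 = 0" and "(\<lambda>n. u n * v (Suc n)) \<longlonglongrightarrow> 0"
  shows "(\<lambda>n. u (Suc n) * (v (Suc n) - v (Suc (Suc n)))) sums S"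
proof -
  have "(\<lambda>n. u (Suc n) * v (Suc (Suc n)) - u n * v (Suc n)) sums (0 - u 0 * v (Suc 0))"
    by (rule telescope_sums[OF assms(3)])
  from sums_diff[OF assms(1) this] show ?thesis
    using assms(2) by (simp add: algebra_simps)
qed

text \<open>
  The boundary terms below are of size \<open>(harm n)\<^sup>2 / n\<close>. They vanish because harmonic
  numbers grow like the logarithm, in particular more slowly than the square root.
\<close>
lemma harm_over_sqrt_tendsto_0: "(\<lambda>n. harm n / sqrt (real n)) \<longlonglongrightarrow> 0"
proof -
  have "(\<lambda>n. (harm n - ln (real n)) * (1 / sqrt (real n)) + ln (real n) / sqrt (real n))
          \<longlonglongrightarrow> euler_mascheroni * 0 + 0"
    by (intro tendsto_add tendsto_mult euler_mascheroni_LIMSEQ; real_asymp)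
  thus ?thesis by (simp add: diff_divide_distrib)
qed

lemma harm_squared_over_linear_tendsto_0:
  assumes "c \<ge> 0"
  shows "(\<lambda>n. (harm n)\<^sup>2 / (real (Suc n) + c)) \<longlonglongrightarrow> 0"
proof (rule real_tendsto_sandwich[where f = "\<lambda>_. 0" and h = "\<lambda>n. (harm n / sqrt (real n))\<^sup>2"])
  show "(\<lambda>n. (harm n / sqrt (real n))\<^sup>2) \<longlonglongrightarrow> 0"
    using tendsto_power[OF harm_over_sqrt_tendsto_0, of 2] by simp
  show "\<forall>\<^sub>F n in sequentially. (harm n)\<^sup>2 / (real (Suc n) + c) \<le> (harm n / sqrt (real n))\<^sup>2"
    using eventually_gt_at_top[of 0]
    by eventually_elim (use assms in \<open>auto simp: power_divide intro!: divide_left_mono\<close>)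
qed (use assms in auto)

lemma harm_over_linear_tendsto_0:
  assumes "c \<ge> 0"
  shows "(\<lambda>n. harm n / (real (Suc n) + c)) \<longlonglongrightarrow> 0"
proof (rule real_tendsto_sandwich[where f = "\<lambda>_. 0" and h = "\<lambda>n. harm n / sqrt (real n)"])
  show "(\<lambda>n. harm n / sqrt (real n)) \<longlonglongrightarrow> 0" by (rule harm_over_sqrt_tendsto_0)
  show "\<forall>\<^sub>F n in sequentially. harm n / (real (Suc n) + c) \<le> harm n / sqrt (real n)"
    using eventually_gt_at_top[of 0]
  proof eventually_elim
    case (elim n)
    have "sqrt (real n) \<le> real n" using elim by (simp add: real_le_lsqrt power2_eq_square)
    thus ?case using elim assms by (auto intro!: divide_left_mono harm_nonneg)
  qed
qed (use assms in \<open>auto simp: harm_nonneg\<close>)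

section \<open>Shifted harmonic numbers\<close>

lemma shifted_harm_plus1:
  fixes x :: real
  assumes "x \<ge> 0"
  shows "shifted_harm (x + 1) = shifted_harm x + 1 / (x + 1)"
  using Digamma_plus1[of "x + 1"] assms by (simp add: shifted_harm_def)

lemma shifted_harm_minus1:
  fixes b :: real
  assumes "b > 0"
  shows "shifted_harm (b - 1) = shifted_harm b - 1 / b"
  using Digamma_plus1[of b] assms by (simp add: shifted_harm_def)

lemma shifted_harm_plus_nat:
  fixes a :: real
  assumes "a > 0"
  shows "shifted_harm (a + real n) = shifted_harm a + param_harm 1 n a"
proof (induction n)
  case (Suc n)
  thus ?case using shifted_harm_plus1[of "a + real n"] assms
    by (simp add: param_harm_def add_ac)
qed (simp add: param_harm_def)

lemma shifted_harm_sums: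
  fixes b :: real
  assumes "b > 0"
  shows "(\<lambda>n. 1 / (real (Suc n) * (real (Suc n) + b))) sums (shifted_harm b / b)"
proof -
  have "(\<lambda>n. inverse (real (Suc n)) - inverse (b + 1 + real n)) sums shifted_harm b"
    using summable_sums[OF summable_Digamma[of "b + 1"]] assms
    by (simp add: shifted_harm_def Digamma_def)
  from sums_divide[OF this, of b] show ?thesis
  proof (rule sums_cong[THEN iffD1, rotated])
    fix n :: nat
    define x where "x = real (Suc n)"
    have "x > 0" "b + 1 + real n = x + b" by (simp_all add: x_def)
    moreover have "(inverse x - inverse (x + b)) / b = 1 / (x * (x + b))"
      using \<open>x > 0\<close> assms by (simp add: divide_simps)
    ultimately show "(inverse (real (Suc n)) - inverse (b + 1 + real n)) / b =
        1 / (real (Suc n) * (real (Suc n) + b))"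
      by (simp add: x_def add_ac)
  qed
qed

lemma summable_hurwitz_zeta_nat_2:
  fixes b :: real
  assumes "b > 0"
  shows "summable (\<lambda>n. 1 / (real n + b)\<^sup>2)"
  using Polygamma_converges'[of b 2] assms by (simp add: inverse_eq_divide add.commute)

lemma riemann_zeta_nat_2_sums:
  "(\<lambda>n. 1 / (real (Suc n))\<^sup>2) sums riemann_zeta_nat 2"
  using summable_sums[OF summable_hurwitz_zeta_nat_2[of 1]]
  by (simp add: riemann_zeta_nat_def add.commute)

lemma shifted_harm2_minus1:
  fixes b :: real
  assumes "b > 0"
  shows "shifted_harm2 (b - 1) = shifted_harm2 b - 1 / b\<^sup>2"
  using suminf_split_head[OF summable_hurwitz_zeta_nat_2[OF assms]]
  by (simp add: shifted_harm2_def hurwitz_zeta_nat_def add_ac)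

lemma shifted_harm_0 [simp]: "shifted_harm (0 :: real) = 0"
  by (simp add: shifted_harm_def)

lemma shifted_harm2_0 [simp]: "shifted_harm2 (0 :: real) = 0"
  by (simp add: shifted_harm2_def riemann_zeta_nat_def hurwitz_zeta_nat_def add.commute)

lemma shifted_harm_mono:
  fixes x y :: real
  assumes "0 \<le> x" "x \<le> y"
  shows "shifted_harm x \<le> shifted_harm y"
  using Digamma_real_mono[of "x + 1" "y + 1"] assms by (simp add: shifted_harm_def)

lemma shifted_harm2_mono:
  fixes x y :: real
  assumes "0 \<le> x" "x \<le> y"
  shows "shifted_harm2 x \<le> shifted_harm2 y"
proof -
  have "(\<Sum>n. 1 / (real n + (y + 1))\<^sup>2) \<le> (\<Sum>n. 1 / (real n + (x + 1))\<^sup>2)"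
    using assms
    by (intro suminf_le summable_hurwitz_zeta_nat_2 divide_left_mono power_mono) auto
  thus ?thesis by (simp add: shifted_harm2_def hurwitz_zeta_nat_def)
qed

section \<open>The linear harmonic series\<close>

text \<open>
  A first-order recurrence determines a function only up to a function of period one;
  monotonicity removes this freedom as soon as the increments tend to zero. Indeed both
  functions agree at the positive integers, so for a natural number \<open>M \<ge> b\<close> the values of \<open>f\<close> and \<open>g\<close> at
  \<open>b + n\<close> lie in the same interval, from the common value at \<open>n\<close> to the one at \<open>n + M\<close>.
  Its length, a sum of \<open>M\<close> increments, tends to zero, while \<open>f (b + n) - g (b + n)\<close>
  does not depend on \<open>n\<close>.
\<close>
lemma eq_of_recurrence_of_mono:
  fixes f g h :: "real \<Rightarrow> real"
  assumes mono_f: "mono_on {1..} f" and mono_g: "mono_on {1..} g"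
    and rec_f: "\<And>x. x > 0 \<Longrightarrow> f (x + 1) = f x + h x"
    and rec_g: "\<And>x. x > 0 \<Longrightarrow> g (x + 1) = g x + h x"
    and "f 1 = g 1" and lim: "(\<lambda>n. h (real n)) \<longlonglongrightarrow> 0" and "b > 0"
  shows "f b = g b"
proof -
  have f_shift: "f (x + real n) = f x + (\<Sum>i<n. h (x + real i))" if "x > 0" for x n
    using rec_f[of "x + real n" for n] that
    by (induction n) (simp_all add: add_ac add_pos_nonneg)
  have g_shift: "g (x + real n) = g x + (\<Sum>i<n. h (x + real i))" if "x > 0" for x n
    using rec_g[of "x + real n" for n] that
    by (induction n) (simp_all add: add_ac add_pos_nonneg)
  have nat_eq: "f (real n) = g (real n)" if "n > 0" for n
    using f_shift[of 1 "n - 1"] g_shift[of 1 "n - 1"] \<open>f 1 = g 1\<close> that by simp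
  obtain M :: nat where M: "b \<le> real M" using real_arch_simple by blast
  have bound: "\<bar>f b - g b\<bar> \<le> (\<Sum>i<M. h (real (n + i)))" if "n > 0" for n
  proof -
    have n: "real n \<ge> 1" using that by simp
    have "f (real n) \<le> f (b + real n)" "f (b + real n) \<le> f (real (n + M))"
      "g (real n) \<le> g (b + real n)" "g (b + real n) \<le> g (real (n + M))"
      using n M \<open>b > 0\<close> by (auto intro!: mono_onD[OF mono_f] mono_onD[OF mono_g])
    moreover have "f b - g b = f (b + real n) - g (b + real n)"
      using f_shift[OF \<open>b > 0\<close>] g_shift[OF \<open>b > 0\<close>] by simp
    moreover have "g (real (n + M)) - g (real n) = (\<Sum>i<M. h (real (n + i)))"
      using g_shift[of "real n" M] that by simp
    moreover have "f (real n) = g (real n)" "f (real (n + M)) = g (real (n + M))"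
      using nat_eq[of n] nat_eq[of "n + M"] that by auto
    ultimately show ?thesis by linarith
  qed
  have "(\<lambda>n. \<Sum>i<M. h (real (n + i))) \<longlonglongrightarrow> (\<Sum>i<M. 0)"
    by (intro tendsto_sum LIMSEQ_ignore_initial_segment[OF lim])
  hence "\<bar>f b - g b\<bar> \<le> 0"
    by (intro tendsto_lowerbound[of "\<lambda>n. \<Sum>i<M. h (real (n + i))"])
       (use bound in \<open>auto intro!: eventually_mono[OF eventually_gt_at_top[of 0]]\<close>)
  thus ?thesis by simp
qed

definition harm_series :: "real \<Rightarrow> real" where
  "harm_series b = (\<Sum>n. harm (Suc n) * (1 / real (Suc n) - 1 / (real (Suc n) + b)))"

text \<open>
  At \<open>b = 1\<close> summation by parts turns \<open>harm n\<close> into its increment \<open>1 / n\<close>, and the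
  reciprocal squares remain.
\<close>
lemma harm_series_sums_1:
  "(\<lambda>n. harm (Suc n) * (1 / real (Suc n) - 1 / (real (Suc n) + 1))) sums riemann_zeta_nat 2"
proof -
  have "(\<lambda>n. harm (Suc n) * (1 / real (Suc n) - 1 / real (Suc (Suc n)))) sums riemann_zeta_nat 2"
  proof (rule Abel_summation_sums)
    show "(\<lambda>n. (harm (Suc n) - harm n) * (1 / real (Suc n))) sums riemann_zeta_nat 2"
      using riemann_zeta_nat_2_sums by (simp add: harm_Suc power2_eq_square divide_simps)
    show "(\<lambda>n. harm n * (1 / real (Suc n))) \<longlonglongrightarrow> 0"
      using harm_over_linear_tendsto_0[of 0] by simp
  qed (simp add: harm_def)
  thus ?thesis by (simp add: add_ac)
qed

lemma harm_series_1: "harm_series 1 = riemann_zeta_nat 2"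
  using harm_series_sums_1 by (simp add: harm_series_def sums_iff)

text \<open>
  Convergence for general \<open>b\<close> follows from the case \<open>b = 1\<close>, since
  \<open>1 / x - 1 / (x + b) \<le> (b + 1) * (1 / x - 1 / (x + 1))\<close> for all positive \<open>x\<close>.
\<close>
lemma harm_series_sums:
  assumes "b > 0"
  shows "(\<lambda>n. harm (Suc n) * (1 / real (Suc n) - 1 / (real (Suc n) + b))) sums harm_series b"
  unfolding harm_series_def
proof (rule summable_sums, rule summable_comparison_test', rule summable_mult)
  show "summable (\<lambda>n. harm (Suc n) * (1 / real (Suc n) - 1 / (real (Suc n) + 1)))"
    using harm_series_sums_1 by (rule sums_summable)
  fix n :: nat
  define x where "x = real (Suc n)"
  have x: "x > 0" by (simp add: x_def)
  have "1 / x - 1 / (x + b) \<ge> 0" using x assms by (simp add: field_simps)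
  moreover have "1 / x - 1 / (x + b) \<le> (b + 1) * (1 / x - 1 / (x + 1))"
  proof -
    have "1 / x - 1 / (x + b) = b / (x * (x + b))" using x assms by (simp add: field_simps)
    also have "\<dots> \<le> (b + 1) / (x * (x + 1))"
    proof -
      have "b * (x + 1) \<le> (b + 1) * (x + b)" using x assms by (simp add: algebra_simps)
      hence "x * (b * (x + 1)) \<le> x * ((b + 1) * (x + b))" using x by (intro mult_left_mono) auto
      thus ?thesis using x assms by (simp add: frac_le_eq divide_simps mult_ac)
    qed
    also have "\<dots> = (b + 1) * (1 / x - 1 / (x + 1))" using x by (simp add: field_simps)
    finally show ?thesis .
  qed
  ultimately have "norm (harm (Suc n) * (1 / x - 1 / (x + b)))
      \<le> harm (Suc n) * ((b + 1) * (1 / x - 1 / (x + 1)))"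
    by (auto simp: abs_mult harm_nonneg intro!: mult_left_mono)
  thus "norm (harm (Suc n) * (1 / real (Suc n) - 1 / (real (Suc n) + b)))
      \<le> (b + 1) * (harm (Suc n) * (1 / real (Suc n) - 1 / (real (Suc n) + 1)))"
    by (simp add: x_def mult_ac)
qed

lemma harm_series_mono:
  assumes "0 < x" "x \<le> y"
  shows "harm_series x \<le> harm_series y"
  using harm_series_sums[of x] harm_series_sums[of y] assms
  by (intro sums_le[of _ _ "harm_series x" "harm_series y"] mult_left_mono diff_left_mono)
     (auto simp: harm_nonneg intro!: frac_le)

text \<open>
  The difference of the two series has the weights \<open>1 / (n + b) - 1 / (n + b + 1)\<close>, so Abel
  summation removes the harmonic numbers and leaves the series for \<open>shifted_harm b / b\<close>.
\<close>
lemma harm_series_plus1: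
  assumes "b > 0"
  shows "harm_series (b + 1) = harm_series b + shifted_harm b / b"
proof -
  have "(\<lambda>n. harm (Suc n) * (1 / (real (Suc n) + b) - 1 / (real (Suc (Suc n)) + b)))
          sums (shifted_harm b / b)"
  proof (rule Abel_summation_sums[where v = "\<lambda>n. 1 / (real n + b)"])
    show "(\<lambda>n. (harm (Suc n) - harm n) * (1 / (real (Suc n) + b))) sums (shifted_harm b / b)"
      using shifted_harm_sums[OF assms] by (simp add: harm_Suc divide_simps)
    show "(\<lambda>n. harm n * (1 / (real (Suc n) + b))) \<longlonglongrightarrow> 0"
      using harm_over_linear_tendsto_0[of b] assms by simp
  qed (simp add: harm_def)
  from sums_add[OF harm_series_sums[OF assms] this]
  have "(\<lambda>n. harm (Suc n) * (1 / real (Suc n) - 1 / (real (Suc n) + (b + 1))))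
          sums (harm_series b + shifted_harm b / b)"
    by (simp add: algebra_simps)
  moreover have "(\<lambda>n. harm (Suc n) * (1 / real (Suc n) - 1 / (real (Suc n) + (b + 1))))
          sums harm_series (b + 1)"
    using harm_series_sums[of "b + 1"] assms by simp
  ultimately show ?thesis by (rule sums_unique2[symmetric])
qed

text \<open>
  On the right-hand side the step from \<open>b\<close> to \<open>b + 1\<close> is
  \<open>((shifted_harm b)\<^sup>2 - (shifted_harm b - 1 / b)\<^sup>2 + 1 / b\<^sup>2) / 2 = shifted_harm b / b\<close>:
  the second-order term cancels the square of \<open>1 / b\<close>. This is the increment of
  \<open>harm_series\<close>, and \<open>eq_of_recurrence_of_mono\<close> applies.
\<close>
lemma harm_series_closed_form:
  assumes "b > 0"
  shows "harm_series b =
           ((shifted_harm (b - 1))\<^sup>2 + shifted_harm2 (b - 1)) / 2 + riemann_zeta_nat 2"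
    (is "_ = ?g b")
proof (rule eq_of_recurrence_of_mono[where h = "\<lambda>x. shifted_harm x / x" and g = ?g])
  show "mono_on {1..} harm_series"
    by (auto intro!: mono_onI harm_series_mono)
  show "mono_on {1..} ?g"
  proof (rule mono_onI)
    fix x y :: real assume xy: "x \<in> {1..}" "y \<in> {1..}" "x \<le> y"
    \<comment> \<open>Squaring preserves the order only for nonnegative values; for \<open>x < 1\<close> this one is negative.\<close>
    have "0 \<le> shifted_harm (x - 1)"
      using shifted_harm_mono[of 0 "x - 1"] xy by simp
    hence "(shifted_harm (x - 1))\<^sup>2 \<le> (shifted_harm (y - 1))\<^sup>2"
      using xy by (intro power_mono shifted_harm_mono) auto
    moreover have "shifted_harm2 (x - 1) \<le> shifted_harm2 (y - 1)"
      using xy by (intro shifted_harm2_mono) auto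
    ultimately show "?g x \<le> ?g y" by simp
  qed
  show "?g (x + 1) = ?g x + shifted_harm x / x" if "x > 0" for x
    using that by (simp add: shifted_harm_minus1 shifted_harm2_minus1 power2_eq_square field_simps)
  show "harm_series 1 = ?g 1" by (simp add: harm_series_1)
  have "(\<lambda>n. shifted_harm (real (Suc n)) / real (Suc n)) \<longlonglongrightarrow> 0"
  proof -
    have "(\<lambda>n. harm n / (real (Suc n) + 0) + 1 / (real (Suc n))\<^sup>2) \<longlonglongrightarrow> 0 + 0"
      by (intro tendsto_add harm_over_linear_tendsto_0 order_refl) real_asymp
    moreover have "harm n / (real (Suc n) + 0) + 1 / (real (Suc n))\<^sup>2
        = shifted_harm (real (Suc n)) / real (Suc n)" for n
      by (simp only: shifted_harm_of_nat harm_Suc)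
         (simp add: power2_eq_square inverse_eq_divide add_divide_distrib del: of_nat_Suc)
    ultimately show ?thesis by simp
  qed
  thus "(\<lambda>n. shifted_harm (real n) / real n) \<longlonglongrightarrow> 0"
    by (rule LIMSEQ_imp_Suc)
qed (use assms harm_series_plus1 in auto)

section \<open>The series of squared harmonic numbers\<close>

text \<open>
  After Abel summation the term is \<open>(2 * harm n / n - 1 / n\<^sup>2) / (n + b)\<close>. Splitting
  \<open>1 / (n * (n + b))\<close> into partial fractions in both parts gives \<open>harm_series\<close>, the
  reciprocal squares, and the series for \<open>shifted_harm b / b\<close>.
\<close>
lemma harm_squared_series_step:
  fixes b :: real
  assumes "b > 0"
  shows "(\<lambda>n. (harm (Suc n))\<^sup>2 * (1 / (real (Suc n) + b) - 1 / (real (Suc (Suc n)) + b))) sums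
           (((shifted_harm b)\<^sup>2 + shifted_harm2 b + riemann_zeta_nat 2) / b - shifted_harm b / b\<^sup>2)"
    (is "_ sums ?T")
proof (rule Abel_summation_sums[where u = "\<lambda>n. (harm n)\<^sup>2" and v = "\<lambda>n. 1 / (real n + b)"])
  have "(\<lambda>n. 2 / b * (harm (Suc n) * (1 / real (Suc n) - 1 / (real (Suc n) + b))) -
             1 / b * (1 / (real (Suc n))\<^sup>2 - 1 / (real (Suc n) * (real (Suc n) + b)))) sums
        (2 / b * harm_series b - 1 / b * (riemann_zeta_nat 2 - shifted_harm b / b))"
    using assms
    by (intro sums_diff sums_mult harm_series_sums riemann_zeta_nat_2_sums shifted_harm_sums)
  moreover have "2 / b * (harm (Suc n) * (1 / real (Suc n) - 1 / (real (Suc n) + b))) -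
             1 / b * (1 / (real (Suc n))\<^sup>2 - 1 / (real (Suc n) * (real (Suc n) + b)))
        = ((harm (Suc n))\<^sup>2 - (harm n)\<^sup>2) * (1 / (real (Suc n) + b))" for n
  proof -
    define x where "x = real (Suc n)"
    define h :: real where "h = harm (Suc n)"
    have x: "x > 0" by (simp add: x_def)
    have "harm n = h - 1 / x" by (simp add: h_def x_def harm_Suc inverse_eq_divide)
    moreover have "2 / b * (h * (1 / x - 1 / (x + b))) - 1 / b * (1 / x\<^sup>2 - 1 / (x * (x + b)))
        = (h\<^sup>2 - (h - 1 / x)\<^sup>2) * (1 / (x + b))"
    proof -
      have 1: "1 / x - 1 / (x + b) = b / (x * (x + b))" using x assms by (simp add: field_simps)
      hence 2: "1 / x\<^sup>2 - 1 / (x * (x + b)) = b / (x\<^sup>2 * (x + b))"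
        using x assms by (simp add: divide_simps power2_eq_square)
      show ?thesis unfolding 1 2 using x assms
        by (simp add: power2_eq_square divide_simps) (simp add: algebra_simps)
    qed
    ultimately show ?thesis by (simp add: x_def h_def)
  qed
  moreover have "2 / b * harm_series b - 1 / b * (riemann_zeta_nat 2 - shifted_harm b / b) = ?T"
    using assms
    by (simp add: harm_series_closed_form shifted_harm_minus1 shifted_harm2_minus1
          power2_eq_square divide_simps) (simp add: algebra_simps)
  ultimately show "(\<lambda>n. ((harm (Suc n))\<^sup>2 - (harm n)\<^sup>2) * (1 / (real (Suc n) + b))) sums ?T"
    by simp
  show "(\<lambda>n. (harm n)\<^sup>2 * (1 / (real (Suc n) + b))) \<longlonglongrightarrow> 0"
    using harm_squared_over_linear_tendsto_0[of b] assms by simp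
qed (simp add: harm_def)

text \<open>
  With \<open>j = i + 1\<close> the numerator is \<open>shifted_harm a + param_harm 1 i a\<close>; the term with \<open>i = 0\<close>
  contributes only \<open>shifted_harm a\<close>, so the sum on the right starts at \<open>i = 1\<close>.
\<close>
lemma sum_shifted_harm_over_square:
  fixes a :: real
  assumes "a > 0"
  shows "(\<Sum>j=1..r. shifted_harm (a + real j - 1) / (a + real j - 1)\<^sup>2) =
           shifted_harm a * param_harm 2 r (a - 1) + (\<Sum>i=1..<r. param_harm 1 i a / (real i + a)\<^sup>2)"
proof (induction r)
  case (Suc r)
  have "(\<Sum>i=1..<Suc r. param_harm 1 i a / (real i + a)\<^sup>2) =
        (\<Sum>i=1..<r. param_harm 1 i a / (real i + a)\<^sup>2) + param_harm 1 r a / (real r + a)\<^sup>2"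
    by (cases r) (auto simp: param_harm_def)
  thus ?case using Suc shifted_harm_plus_nat[OF assms, of r]
    by (simp add: param_harm_def algebra_simps add_divide_distrib)
qed (simp add: param_harm_def)

lemma harm_squared_series:
  fixes a :: real
  assumes "a > 0"
  shows "(\<lambda>n. (harm (Suc n))\<^sup>2 * (1 / (real (Suc n) + a) - 1 / (real (Suc n) + a + real r))) sums
          (riemann_zeta_nat 2 * param_harm 1 r (a - 1)
             - shifted_harm a * param_harm 2 r (a - 1)
             - (\<Sum>i=1..<r. param_harm 1 i a / (real i + a)\<^sup>2)
             + (\<Sum>j=1..r. ((shifted_harm (a + real j - 1))\<^sup>2 + shifted_harm2 (a + real j - 1))
                          / (a + real j - 1)))" (is "_ sums ?S")
proof -
  let ?b = "\<lambda>j. a + real j - 1"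
  have "(\<lambda>n. \<Sum>j=1..r. (harm (Suc n))\<^sup>2 * (1 / (real (Suc n) + ?b j) - 1 / (real (Suc (Suc n)) + ?b j)))
      sums (\<Sum>j=1..r. ((shifted_harm (?b j))\<^sup>2 + shifted_harm2 (?b j) + riemann_zeta_nat 2) / ?b j
                 - shifted_harm (?b j) / (?b j)\<^sup>2)"
    using assms by (intro sums_sum harm_squared_series_step) auto
  moreover have "(\<Sum>j=1..r. (harm (Suc n))\<^sup>2 *
        (1 / (real (Suc n) + ?b j) - 1 / (real (Suc (Suc n)) + ?b j))) =
      (harm (Suc n))\<^sup>2 * (1 / (real (Suc n) + a) - 1 / (real (Suc n) + a + real r))" for n
    by (induction r) (simp_all add: algebra_simps)
  moreover have "(\<Sum>j=1..r. ((shifted_harm (?b j))\<^sup>2 + shifted_harm2 (?b j) + riemann_zeta_nat 2) / ?b j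
                 - shifted_harm (?b j) / (?b j)\<^sup>2) = ?S"
  proof -
    have "riemann_zeta_nat 2 * param_harm 1 r (a - 1) = (\<Sum>j=1..r. riemann_zeta_nat 2 / ?b j)"
      by (simp add: param_harm_def sum_distrib_left algebra_simps)
    thus ?thesis using sum_shifted_harm_over_square[OF assms, of r]
      by (simp add: add_divide_distrib sum.distrib sum_subtractf)
  qed
  ultimately show ?thesis by simp
qed

section \<open>Partial fractions of the reciprocal binomial coefficient\<close>

text \<open>
  Pascal's rule, read for finite differences: up to sign, the sums are the differences of
  \<open>f\<close> of order \<open>k + 1\<close> at \<open>0\<close> and of order \<open>k\<close> at \<open>0\<close> and \<open>1\<close>.
\<close>
lemma alternating_binomial_sum_Suc:
  fixes f :: "nat \<Rightarrow> real"
  shows "(\<Sum>r\<le>Suc k. (-1) ^ r * real (Suc k choose r) * f r) =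
         (\<Sum>r\<le>k. (-1) ^ r * real (k choose r) * f r) -
         (\<Sum>r\<le>k. (-1) ^ r * real (k choose r) * f (Suc r))"
proof -
  have "(\<Sum>r\<le>Suc k. (-1) ^ r * real (Suc k choose r) * f r) =
     f 0 + (\<Sum>r\<le>k. (-1) ^ Suc r * real (k choose Suc r) * f (Suc r)) -
       (\<Sum>r\<le>k. (-1) ^ r * real (k choose r) * f (Suc r))"
    by (subst sum.atMost_Suc_shift) (simp add: algebra_simps sum.distrib sum_negf sum_subtractf)
  also have "f 0 + (\<Sum>r\<le>k. (-1) ^ Suc r * real (k choose Suc r) * f (Suc r)) =
     (\<Sum>r\<le>Suc k. (-1) ^ r * real (k choose r) * f r)"
    by (subst sum.atMost_Suc_shift) simp
  also have "\<dots> = (\<Sum>r\<le>k. (-1) ^ r * real (k choose r) * f r)"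
    by simp
  finally show ?thesis .
qed

text \<open>
  Write \<open>R k x\<close> for the left-hand side. Both sides obey the same recursion in \<open>k\<close>: the right
  one by Pascal's rule, and \<open>R (k + 1) x = R k x - R k (x + 1)\<close> because
  \<open>R k (x + 1) = R k x * x / (x + k + 1)\<close>.
\<close>
lemma reciprocal_gbinomial_partial_fractions:
  fixes x :: real
  assumes "x > 0"
  shows "1 / (x * ((x + real k) gchoose k)) = (\<Sum>r\<le>k. (-1) ^ r * real (k choose r) * (1 / (x + real r)))"
  using assms
proof (induction k arbitrary: x)
  case (Suc k)
  define c where "c = ((x + real k) gchoose k)"
  have "c > 0" unfolding c_def gbinomial_pochhammer'
    using Suc.prems by (simp add: pochhammer_pos)
  have "(x + real (Suc k)) gchoose Suc k = (x + real k + 1) / real (Suc k) * c"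
    using gbinomial_factors[of "x + real k" k] by (simp add: c_def add_ac)
  moreover have "(x + 1) * ((x + 1 + real k) gchoose k) = (x + real k + 1) * c"
    using gbinomial_absorb_comp[of "x + 1 + real k" k] by (simp add: c_def add_ac)
  moreover have "1 / (x * (p / q * c)) = 1 / (x * c) - 1 / (p * c)" if "p = x + q" "q > 0" for p q
    using \<open>c > 0\<close> Suc.prems that by (simp add: divide_simps)
  from this[of "x + real k + 1" "real (Suc k)"]
  have "1 / (x * ((x + real k + 1) / real (Suc k) * c)) = 1 / (x * c) - 1 / ((x + real k + 1) * c)"
    by simp
  ultimately have "1 / (x * ((x + real (Suc k)) gchoose Suc k)) =
     1 / (x * c) - 1 / ((x + 1) * ((x + 1 + real k) gchoose k))"
    by simp
  thus ?case using Suc.IH[of x] Suc.IH[of "x + 1"] Suc.prems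
    by (subst alternating_binomial_sum_Suc) (simp add: c_def add_ac)
qed simp

text \<open>
  For \<open>k \<ge> 1\<close> the alternating binomial coefficients sum to zero, so \<open>1 / x\<close> may be
  subtracted from every partial fraction. The differences are what makes the series
  against \<open>(harm n)\<^sup>2\<close> converge for each \<open>r\<close> separately.
\<close>
lemma reciprocal_gbinomial_differences:
  fixes x :: real
  assumes "x > 0" "k \<ge> 1"
  shows "1 / (x * ((x + real k) gchoose k)) =
           (\<Sum>r=1..k. (-1) ^ (r + 1) * real (k choose r) * (1 / x - 1 / (x + real r)))"
proof -
  have "(\<Sum>r=1..k. (-1) ^ (r + 1) * real (k choose r) * (1 / x - 1 / (x + real r))) =
        (\<Sum>r\<le>k. (-1) ^ (r + 1) * real (k choose r) * (1 / x - 1 / (x + real r)))"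
    by (rule sum.mono_neutral_left) (auto simp: not_le)
  also have "\<dots> = (\<Sum>r\<le>k. (-1) ^ r * real (k choose r) * (1 / (x + real r))) -
                  (\<Sum>r\<le>k. (-1) ^ r * real (k choose r)) * (1 / x)"
    by (simp add: sum_divide_distrib right_diff_distrib sum_subtractf sum_negf)
  also have "(\<Sum>r\<le>k. (-1) ^ r * real (k choose r)) = 0"
    using assms by (intro choose_alternating_sum) auto
  finally show ?thesis using reciprocal_gbinomial_partial_fractions[OF assms(1)] by simp
qed

section \<open>The series with a binomial coefficient in the denominator\<close>

theorem theorem4p5:
  fixes a :: real and k :: nat
  assumes "a > 0" and "k \<ge> 1"
  shows "(\<lambda>m. let n = Suc m in
            (harm n)\<^sup>2 / ((real n + a) * ((real n + real k + a) gchoose k)))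
         sums
         (\<Sum>r=1..k. (-1) ^ (r + 1) * real (k choose r) *
            (riemann_zeta_nat 2 * param_harm 1 r (a - 1)
             - shifted_harm a * param_harm 2 r (a - 1)
             - (\<Sum>i=1..<r. param_harm 1 i a / (real i + a)\<^sup>2)
             + (\<Sum>j=1..r. ((shifted_harm (a + real j - 1))\<^sup>2 + shifted_harm2 (a + real j - 1))
                          / (a + real j - 1))))" (is "_ sums ?S")
proof -
  have "(\<lambda>m. \<Sum>r=1..k. (-1) ^ (r + 1) * real (k choose r) *
      ((harm (Suc m))\<^sup>2 * (1 / (real (Suc m) + a) - 1 / (real (Suc m) + a + real r)))) sums ?S"
    by (intro sums_sum sums_mult harm_squared_series assms)
  moreover have "(\<Sum>r=1..k. (-1) ^ (r + 1) * real (k choose r) *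
      ((harm (Suc m))\<^sup>2 * (1 / (real (Suc m) + a) - 1 / (real (Suc m) + a + real r)))) =
      (let n = Suc m in (harm n)\<^sup>2 / ((real n + a) * ((real n + real k + a) gchoose k)))" for m
  proof -
    let ?x = "real (Suc m) + a"
    have "(\<Sum>r=1..k. (-1) ^ (r + 1) * real (k choose r) *
      ((harm (Suc m))\<^sup>2 * (1 / ?x - 1 / (?x + real r)))) =
      (harm (Suc m))\<^sup>2 * (1 / (?x * ((?x + real k) gchoose k)))"
      using assms by (subst reciprocal_gbinomial_differences) (auto simp: sum_distrib_left mult_ac)
    also have "?x + real k = real (Suc m) + real k + a" by simp
    finally show ?thesis by (simp only: Let_def times_divide_eq_right mult_1_right)
  qed
  ultimately show ?thesis by simp
qed

end
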